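(* Let $p$ be a prime and suppose $E\subset\mathbb{F}_p^2$ $k$-tiles $\mathbb{F}_p^2$ by some $A\subset\mathbb{F}_p^2$. Then either $|E|=k$ and $A=\mathbb{F}_p^2$, or $E=\mathbb{F}_p^2$ and $|A|=k$, or $|E|=sp$ for some integer $1\le s\le p-1$ such that $s$ divides $k$, and $E$ is the union of $s$ pairwise disjoint graphs, i.e., there are a basis $\{e_1,e_2\}$ of $\mathbb{F}_p^2$ and functions $f_1,\dots,f_s:\mathbb{F}_p\to\mathbb{F}_p$ with $E=\bigcup_{i=1}^s\{xe_1+f_i(x)e_2: x\in\mathbb{F}_p\}$, the union being disjoint.
   Context: $E$ $k$-tiles $\mathbb{F}_p^d$ by $A$ means $\sum_{a\in A}1_E(x-a)=k$ for every $x\in\mathbb{F}_p^d$, where $1_E$ is the indicator function of $E$ and $k\ge1$ is an integer. *)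

theory Defs
  imports "HOL-Analysis.Analysis" "Berlekamp_Zassenhaus.Finite_Field"
begin

text \<open>
  The field with \<open>p\<close> elements is \<^typ>\<open>'p::prime_card mod_ring\<close> with \<open>p = CARD('p)\<close>; the
  class \<^class>\<open>prime_card\<close> says exactly that \<open>CARD('p)\<close> is prime.
\<close>

definition k_tiles ::
    "nat \<Rightarrow> ('p::prime_card mod_ring ^ 'd) set \<Rightarrow> ('p mod_ring ^ 'd) set \<Rightarrow> bool" where
  "k_tiles k E A \<longleftrightarrow> k \<ge> 1 \<and> (\<forall>x. (\<Sum>a\<in>A. indicator E (x - a)) = k)"

definition is_basis2 ::
    "'p::prime_card mod_ring ^ 2 \<Rightarrow> 'p mod_ring ^ 2 \<Rightarrow> bool" where
  "is_basis2 e\<^sub>1 e\<^sub>2 \<longleftrightarrow>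
     e\<^sub>1 \<noteq> e\<^sub>2 \<and> vec.independent {e\<^sub>1, e\<^sub>2} \<and> vec.span {e\<^sub>1, e\<^sub>2} = UNIV"

definition graph_in ::
    "'p::prime_card mod_ring ^ 2 \<Rightarrow> 'p mod_ring ^ 2 \<Rightarrow> ('p mod_ring \<Rightarrow> 'p mod_ring)
      \<Rightarrow> ('p mod_ring ^ 2) set" where
  "graph_in e\<^sub>1 e\<^sub>2 f = {x *s e\<^sub>1 + f x *s e\<^sub>2 | x. True}"

end

theory Submission
  imports Defs
begin

text \<open>
  Project the tiling along a nonzero linear functional \<open>l\<close> to \<open>\<int>/p\<close> and record the fibre sizes
  of \<open>E\<close> and \<open>A\<close> as integer polynomials of degree less than \<open>p\<close>. Modulo \<open>X^p - 1\<close>, their product is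
  a multiple of \<open>1 + X + \<dots> + X^(p - 1)\<close>. This polynomial is prime in \<open>\<int>[X]\<close>, so it divides one of
  the two factors, which means that \<open>E\<close> or \<open>A\<close> meets all fibres of \<open>l\<close> in equally many points.
  A nonempty set for which this happens in all directions is the whole space. Hence, if neither
  \<open>A\<close> nor \<open>E\<close> is the whole plane, \<open>E\<close> is equidistributed along some \<open>l\<close>, with fibres of size \<open>s\<close>,
  and \<open>A\<close> along some \<open>m\<close>, with fibres of size \<open>r\<close>. The identity \<open>|A| |E| = k p^2\<close> becomes
  \<open>r s = k\<close>, and the parallel lines \<open>l = t\<close> carry the \<open>s\<close> graphs.
\<close>

hide_const (open) up_ring.monom up_ring.coeff module.smult

section \<open>The polynomial \<open>1 + X + ... + X^(p - 1)\<close> and its primality in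
  \<open>int poly\<close>\<close>

definition all_ones_poly :: "nat \<Rightarrow> int poly" where
  "all_ones_poly n = (\<Sum>i<n. monom 1 i)"

lemma coeff_all_ones_poly: "coeff (all_ones_poly n) i = (if i < n then 1 else 0)"
  by (simp add: all_ones_poly_def coeff_sum)

lemma degree_all_ones_poly: "n > 0 \<Longrightarrow> degree (all_ones_poly n) = n - 1"
  by (rule antisym, rule degree_le) (auto intro!: le_degree simp: coeff_all_ones_poly)

lemma poly_all_ones_poly_1: "poly (all_ones_poly n) 1 = int n"
  by (simp add: all_ones_poly_def poly_sum poly_monom)

lemma all_ones_poly_mult: "all_ones_poly n * [:-1, 1:] = monom 1 n - 1"
proof (induction n)
  case (Suc n)
  have "monom (1::int) n * [:-1, 1:] = monom 1 (Suc n) - monom 1 n"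
    by (simp add: monom_Suc flip: minus_monom)
  with Suc show ?case
    by (simp add: all_ones_poly_def algebra_simps)
qed (simp add: all_ones_poly_def)

text \<open>As \<open>c\<close> is not a root of \<open>f\<close>, it is a root of \<open>g\<close>,
  so one factor \<open>X - c\<close> cancels on both sides; by induction nothing but a constant is
  left for \<open>f\<close>.\<close>

lemma degree_dvd_linear_power:
  fixes f g :: "'a::field poly"
  assumes "f * g = [:-c, 1:] ^ n" and "poly f c \<noteq> 0"
  shows "degree f = 0"
  using assms
proof (induction n arbitrary: g)
  case 0
  then have "f dvd 1" by (metis dvd_triv_left power_0)
  then show ?case by (simp add: poly_dvd_1)
next
  case (Suc n)
  have "poly (f * g) c = 0"
    unfolding Suc.prems(1) by simp
  then have "poly g c = 0"
    using Suc.prems(2) by simp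
  then obtain h where h: "g = [:-c, 1:] * h"
    by (metis dvdE poly_eq_0_iff_dvd)
  have "[:-c, 1:] * (f * h) = [:-c, 1:] * [:-c, 1:] ^ n"
    using Suc.prems(1) by (simp only: h mult.left_commute power_Suc)
  then have "f * h = [:-c, 1:] ^ n"
    by (metis mult_cancel_left pCons_eq_0_iff zero_neq_one)
  then show ?case using Suc by blast
qed

text \<open>Over the field with \<open>p\<close> elements, \<open>(X - 1) (1 + X + \<dots> + X^(p - 1)) = (X - 1)^p\<close>.\<close>

lemma card_dvd_poly_1_of_dvd_all_ones_poly:
  fixes f :: "int poly"
  assumes "f dvd all_ones_poly CARD('p::prime_card)" and "degree f > 0"
  shows "int CARD('p) dvd poly f 1"
proof -
  let ?p = "CARD('p)"
  define red :: "int poly \<Rightarrow> 'p mod_ring poly" where "red = map_poly of_int"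
  have red_mult: "red (u * v) = red u * red v" for u v
    unfolding red_def by (rule of_int_poly_hom.hom_mult)
  obtain g where g: "all_ones_poly ?p = f * g"
    using assms(1) by (auto elim: dvdE)
  have p0: "?p > 0" by simp
  \<comment> \<open>The product is monic, so the leading coefficient of \<open>f\<close> is a unit
    of the integers and survives reduction modulo \<open>p\<close>.\<close>
  have "lead_coeff f * lead_coeff g = 1"
    using degree_all_ones_poly[OF p0] coeff_all_ones_poly[of ?p "?p - 1"] p0
    by (metis g lead_coeff_mult diff_less zero_less_one)
  then have "lead_coeff f = 1 \<or> lead_coeff f = -1"
    by (metis zmult_eq_1_iff)
  then have deg: "degree (red f) = degree f"
    unfolding red_def by (intro degree_map_poly) auto
  have "red f * (red g * red [:-1, 1:]) = red (monom 1 ?p - 1)"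
    by (simp only: g mult.assoc flip: all_ones_poly_mult red_mult)
  also have "red (monom 1 ?p - 1) = monom 1 ?p - 1"
    by (simp add: red_def of_int_poly_hom.hom_minus map_poly_monom)
  also have "\<dots> = [:-1, 1:] ^ ?p"
  proof -
    have ch: "CHAR('p mod_ring poly) = ?p" by simp
    \<comment> \<open>Freshman's dream for \<open>X = (X - 1) + 1\<close> gives
      \<open>X^p = (X - 1)^p + 1\<close>.\<close>
    have "([:-1, 1:] + 1 :: 'p mod_ring poly) ^ ?p = [:-1, 1:] ^ ?p + 1 ^ ?p"
      using ch prime_card[where 'a = 'p] by (intro freshmans_dream) simp_all
    moreover have "([:-1, 1:] + 1 :: 'p mod_ring poly) = monom 1 1"
      by (simp add: monom_altdef one_pCons)
    ultimately show ?thesis by (simp add: monom_power)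
  qed
  \<comment> \<open>Otherwise \<open>red f\<close>, as a divisor of \<open>(X - 1)^p\<close> that
    does not vanish at 1, would be constant.\<close>
  finally have "poly (red f) 1 = 0"
    using degree_dvd_linear_power deg assms(2) by fastforce
  then have "of_int (poly f 1) = (0 :: 'p mod_ring)"
    unfolding red_def using of_int_hom.poly_map_poly[of f 1, where ?'a = "'p mod_ring"] by simp
  then show ?thesis
    by (simp add: of_int_eq_0_iff_char_dvd)
qed

text \<open>Eisenstein's argument, read off at \<open>X = 1\<close>: in a product of two nonconstant
  factors both values at 1 would be multiples of \<open>p\<close>, but the value of the product is
  \<open>p\<close>. Irreducibility suffices because \<open>int poly\<close> is factorial.\<close>

lemma prime_elem_all_ones_poly: "prime_elem (all_ones_poly CARD('p::prime_card))"
proof (rule Factorial_Ring.irreducible_imp_prime_elem, rule Factorial_Ring.irreducibleI)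
  let ?p = "CARD('p)"
  have p: "prime ?p" by (rule prime_card)
  then have p2: "?p \<ge> 2" by (rule prime_ge_2_nat)
  show "all_ones_poly ?p \<noteq> 0"
    using degree_all_ones_poly[of ?p] p2 by auto
  show "\<not> all_ones_poly ?p dvd 1"
    using degree_all_ones_poly[of ?p] p2 by (auto simp: poly_dvd_1)
  fix a b assume ab: "all_ones_poly ?p = a * b"
  \<comment> \<open>A constant factor divides the constant coefficient, which is 1.\<close>
  have unit: "u dvd 1" if uv: "all_ones_poly ?p = u * v" and "degree u = 0" for u v
  proof -
    obtain c where c: "u = [:c:]" using \<open>degree u = 0\<close> by (rule degree_eq_zeroE)
    have "coeff (all_ones_poly ?p) 0 = c * coeff v 0"
      by (simp add: uv c)
    then have "c dvd 1" by (metis coeff_all_ones_poly dvd_triv_left zero_less_card_finite)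
    then show ?thesis by (simp add: c)
  qed
  show "a dvd 1 \<or> b dvd 1"
  proof (rule ccontr)
    assume "\<not> (a dvd 1 \<or> b dvd 1)"
    then have "degree a > 0" "degree b > 0"
      using unit ab mult.commute by (metis gr0I)+
    then have "int ?p dvd poly a 1" "int ?p dvd poly b 1"
      using ab by (auto intro!: card_dvd_poly_1_of_dvd_all_ones_poly)
    then have "int ?p * int ?p dvd poly (a * b) 1"
      by (simp add: mult_dvd_mono)
    then have "int ?p * int ?p dvd int ?p"
      by (simp only: poly_all_ones_poly_1 flip: ab)
    then have "?p dvd 1" by simp
    then show False using p2 by simp
  qed
qed

section \<open>Fibre sizes as coefficients, and equidistribution as divisibility\<close>

definition residue_index :: "'p::prime_card mod_ring \<Rightarrow> nat" where
  "residue_index t = nat (to_int_mod_ring t)"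

lemma residue_index_less: "residue_index (t :: 'p::prime_card mod_ring) < CARD('p)"
  using range_to_int_mod_ring[where 'a = 'p] unfolding residue_index_def
  by (metis atLeastLessThan_iff nat_less_iff rangeI)

lemma of_nat_residue_index: "of_nat (residue_index t) = (t :: 'p::prime_card mod_ring)"
  using range_to_int_mod_ring[where 'a = 'p]
  by (auto simp: residue_index_def of_nat_of_int_mod_ring)

lemma residue_index_eq_iff: "residue_index s = residue_index t \<longleftrightarrow> s = t"
  by (metis of_nat_residue_index)

lemma residue_index_of_nat:
  "n < CARD('p) \<Longrightarrow> residue_index (of_nat n :: 'p::prime_card mod_ring) = n"
  by (simp add: residue_index_def of_nat_of_int_mod_ring)

lemma residue_index_add:
  fixes s t :: "'p::prime_card mod_ring"
  shows "residue_index (s + t) = (residue_index s + residue_index t) mod CARD('p)"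
proof -
  have "s + t = of_nat ((residue_index s + residue_index t) mod CHAR('p mod_ring))"
    by (simp only: of_nat_mod_CHAR of_nat_add of_nat_residue_index)
  then show ?thesis
    by (simp add: residue_index_of_nat)
qed

text \<open>Modulo \<open>X^p - 1\<close> this is the image of \<open>S\<close> in the group ring of
  the integers modulo \<open>p\<close>, where multiplication is convolution of fibre sizes.\<close>

definition fibre_poly :: "('v \<Rightarrow> 'p::prime_card mod_ring) \<Rightarrow> 'v set \<Rightarrow> int poly" where
  "fibre_poly \<phi> S = (\<Sum>v\<in>S. monom 1 (residue_index (\<phi> v)))"

lemma coeff_fibre_poly:
  fixes S :: "'v::finite set"
  shows "coeff (fibre_poly \<phi> S) (residue_index t) = int (card {v \<in> S. \<phi> v = t})"
  by (simp add: fibre_poly_def coeff_sum residue_index_eq_iff sum.If_cases Int_def)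

lemma coeff_fibre_poly_ge:
  fixes \<phi> :: "'v \<Rightarrow> 'p::prime_card mod_ring"
  shows "n \<ge> CARD('p) \<Longrightarrow> coeff (fibre_poly \<phi> S) n = 0"
  using residue_index_less[where 'p = 'p]
  by (auto simp: fibre_poly_def coeff_sum not_less[symmetric] intro!: sum.neutral)

definition equidistributed :: "('v \<Rightarrow> 'w) \<Rightarrow> 'v set \<Rightarrow> bool" where
  "equidistributed \<phi> S \<longleftrightarrow> (\<exists>c. \<forall>t. card {v \<in> S. \<phi> v = t} = c)"

text \<open>Both polynomials have degree at most \<open>p - 1\<close>, and
  \<open>all_ones_poly\<close> attains it; hence the quotient is a constant, which is the common
  fibre size.\<close>

lemma all_ones_poly_dvd_fibre_poly_iff:
  fixes \<phi> :: "'v::finite \<Rightarrow> 'p::prime_card mod_ring"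
  shows "all_ones_poly CARD('p) dvd fibre_poly \<phi> S \<longleftrightarrow> equidistributed \<phi> S"
proof
  assume "equidistributed \<phi> S"
  then obtain c where c: "\<And>t. card {v \<in> S. \<phi> v = t} = c"
    by (auto simp: equidistributed_def)
  have "fibre_poly \<phi> S = smult (int c) (all_ones_poly CARD('p))"
  proof (rule poly_eqI)
    fix n
    show "coeff (fibre_poly \<phi> S) n = coeff (smult (int c) (all_ones_poly CARD('p))) n"
    proof (cases "n < CARD('p)")
      case True
      then show ?thesis
        using coeff_fibre_poly[of \<phi> S "of_nat n"] c
        by (simp add: residue_index_of_nat coeff_all_ones_poly)
    qed (simp add: coeff_fibre_poly_ge coeff_all_ones_poly)
  qed
  then show "all_ones_poly CARD('p) dvd fibre_poly \<phi> S"
    by (simp add: dvd_smult)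
next
  assume "all_ones_poly CARD('p) dvd fibre_poly \<phi> S"
  then obtain q where q: "fibre_poly \<phi> S = all_ones_poly CARD('p) * q" ..
  have ones: "all_ones_poly CARD('p) \<noteq> 0" "degree (all_ones_poly CARD('p)) = CARD('p) - 1"
    using coeff_all_ones_poly[of "CARD('p)" 0] by (auto simp: degree_all_ones_poly)
  have "degree (fibre_poly \<phi> S) \<le> CARD('p) - 1"
    by (rule degree_le) (auto intro!: coeff_fibre_poly_ge)
  then have "degree q = 0"
  proof (cases "q = 0")
    case False
    then have "degree (fibre_poly \<phi> S) = CARD('p) - 1 + degree q"
      using degree_mult_eq[OF ones(1) False] ones(2) by (simp only: q)
    with \<open>degree (fibre_poly \<phi> S) \<le> CARD('p) - 1\<close> show ?thesis by linarith
  qed simp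
  then obtain c where "q = [:c:]" by (rule degree_eq_zeroE)
  then have "int (card {v \<in> S. \<phi> v = t}) = c" for t
    using coeff_fibre_poly[of \<phi> S t] q residue_index_less[of t]
    by (simp add: coeff_all_ones_poly)
  then show "equidistributed \<phi> S"
    unfolding equidistributed_def by (metis nat_int)
qed

lemma equidistributed_card:
  fixes \<phi> :: "'v::finite \<Rightarrow> 'p::prime_card mod_ring"
  assumes "\<And>t. card {v \<in> S. \<phi> v = t} = c"
  shows "card S = c * CARD('p)"
  using sum.group[of S UNIV \<phi> "\<lambda>_. 1::nat"] assms by (simp add: mult.commute)

text \<open>All fibres are translates of the kernel.\<close>

lemma equidistributed_UNIV:
  fixes \<phi> :: "'v::{finite,ab_group_add} \<Rightarrow> 'p::prime_card mod_ring"
  assumes add: "\<And>u v. \<phi> (u + v) = \<phi> u + \<phi> v" and "surj \<phi>"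
  shows "equidistributed \<phi> UNIV"
proof -
  have "card {v. \<phi> v = t} = card {v. \<phi> v = 0}" for t
  proof -
    obtain u where u: "\<phi> u = t" using \<open>surj \<phi>\<close> by (metis surjD)
    have "(\<lambda>v. v + u) ` {v. \<phi> v = 0} = {v. \<phi> v = t}"
    proof (intro equalityI subsetI)
      fix v assume "v \<in> {v. \<phi> v = t}"
      then have "v - u \<in> {v. \<phi> v = 0}"
        using add[of "v - u" u] u by simp
      then show "v \<in> (\<lambda>v. v + u) ` {v. \<phi> v = 0}"
        by (metis diff_add_cancel imageI)
    qed (auto simp: add u)
    moreover have "inj_on (\<lambda>v. v + u) {v. \<phi> v = 0}" by simp
    ultimately show ?thesis using card_image by metis
  qed
  then show ?thesis by (auto simp: equidistributed_def)
qed

section \<open>Projecting a tiling\<close>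

text \<open>Exponents may be reduced modulo \<open>p\<close>, because \<open>all_ones_poly p\<close>
  divides \<open>X^p - 1\<close>. This is needed as \<open>residue_index\<close> is additive only
  modulo \<open>p\<close>.\<close>

lemma all_ones_poly_dvd_monom_diff:
  "all_ones_poly p dvd monom 1 m - monom 1 (m mod p)"
proof -
  have base: "all_ones_poly p dvd monom 1 p - 1"
    unfolding all_ones_poly_mult[symmetric] by (rule dvd_triv_left)
  have "all_ones_poly p dvd monom 1 (p * q + r) - monom 1 r" for q r
  proof (induction q)
    case (Suc q)
    have "monom 1 (p * Suc q + r) - monom 1 r
        = monom 1 (p * q + r) * (monom 1 p - 1) + (monom (1::int) (p * q + r) - monom 1 r)"
      by (simp add: algebra_simps mult_monom)
    then show ?case using Suc base by (simp only:) (intro dvd_add dvd_mult)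
  qed simp
  from this[of "m div p" "m mod p"] show ?thesis by simp
qed

text \<open>The translates of \<open>E\<close> by \<open>A\<close> cover every point
  \<open>k\<close> times. Monomials for \<open>g\<close> give the polynomial identity, and
  \<open>g = 1\<close> gives the cardinalities.\<close>

lemma sum_tiling:
  fixes E A :: "'v::{finite,ab_group_add} set" and g :: "'v \<Rightarrow> 'r::comm_ring_1"
  assumes "\<And>x. (\<Sum>a\<in>A. indicator E (x - a)) = k"
  shows "(\<Sum>a\<in>A. \<Sum>v\<in>E. g (v + a)) = of_nat k * (\<Sum>x\<in>UNIV. g x)"
proof -
  have "(\<Sum>v\<in>E. g (v + a)) = (\<Sum>x\<in>UNIV. of_nat (indicator E (x - a)) * g x)" for a
  proof -
    have "(\<Sum>v\<in>E. g (v + a)) = (\<Sum>v\<in>UNIV. of_nat (indicator E v) * g (v + a))"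
      by (simp add: indicator_def if_distrib[of of_nat] if_distrib[of "\<lambda>x. x * _"] sum.If_cases
        cong: if_cong)
    also have "\<dots> = (\<Sum>x\<in>UNIV. of_nat (indicator E (x - a)) * g x)"
      by (rule sum.reindex_bij_witness[of _ "\<lambda>x. x - a" "\<lambda>v. v + a"]) auto
    finally show ?thesis .
  qed
  then have "(\<Sum>a\<in>A. \<Sum>v\<in>E. g (v + a)) = (\<Sum>a\<in>A. \<Sum>x\<in>UNIV. of_nat (indicator E (x - a)) * g x)"
    by simp
  also have "\<dots> = (\<Sum>x\<in>UNIV. of_nat (\<Sum>a\<in>A. indicator E (x - a)) * g x)"
    by (subst sum.swap) (simp add: sum_distrib_right)
  finally show ?thesis by (simp add: assms sum_distrib_left)
qed

lemma tiling_equidistributed: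
  fixes E A :: "'v::{finite,ab_group_add} set" and \<phi> :: "'v \<Rightarrow> 'p::prime_card mod_ring"
  assumes tiling: "\<And>x. (\<Sum>a\<in>A. indicator E (x - a)) = (k::nat)"
    and add: "\<And>u v. \<phi> (u + v) = \<phi> u + \<phi> v" and "surj \<phi>"
  shows "equidistributed \<phi> E \<or> equidistributed \<phi> A"
proof -
  let ?C = "all_ones_poly CARD('p)"
  have "fibre_poly \<phi> E * fibre_poly \<phi> A
      = (\<Sum>a\<in>A. \<Sum>v\<in>E. monom 1 (residue_index (\<phi> v) + residue_index (\<phi> a)))"
    unfolding fibre_poly_def sum_product by (subst sum.swap) (simp add: mult_monom)
  \<comment> \<open>Splitting off the error of reducing exponents, a multiple of \<open>?C\<close>,
    leaves a sum to which the tiling applies.\<close>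
  also have "\<dots> = (\<Sum>a\<in>A. \<Sum>v\<in>E. monom 1 (residue_index (\<phi> v) + residue_index (\<phi> a))
        - monom 1 (residue_index (\<phi> (v + a))))
      + (\<Sum>a\<in>A. \<Sum>v\<in>E. monom 1 (residue_index (\<phi> (v + a))))"
    by (simp add: sum_subtractf)
  also have "(\<Sum>a\<in>A. \<Sum>v\<in>E. monom 1 (residue_index (\<phi> (v + a)))) = of_nat k * fibre_poly \<phi> UNIV"
    unfolding fibre_poly_def by (rule sum_tiling[OF tiling])
  finally have "fibre_poly \<phi> E * fibre_poly \<phi> A
    = (\<Sum>a\<in>A. \<Sum>v\<in>E. monom 1 (residue_index (\<phi> v) + residue_index (\<phi> a))
        - monom 1 (residue_index (\<phi> (v + a)))) + of_nat k * fibre_poly \<phi> UNIV" .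
  moreover have "?C dvd of_nat k * fibre_poly \<phi> UNIV"
    using equidistributed_UNIV[OF add \<open>surj \<phi>\<close>] all_ones_poly_dvd_fibre_poly_iff[of \<phi> UNIV]
    by (intro dvd_mult) simp
  ultimately have "?C dvd fibre_poly \<phi> E * fibre_poly \<phi> A"
    by (simp only:) (intro dvd_add dvd_sum, auto simp: add residue_index_add all_ones_poly_dvd_monom_diff)
  then have "?C dvd fibre_poly \<phi> E \<or> ?C dvd fibre_poly \<phi> A"
    using prime_elem_all_ones_poly prime_elem_dvd_mult_iff by blast
  then show ?thesis by (simp add: all_ones_poly_dvd_fibre_poly_iff)
qed

section \<open>Linear functionals and sets equidistributed in all directions\<close>

definition dotp :: "'p::prime_card mod_ring ^ 'd \<Rightarrow> 'p mod_ring ^ 'd \<Rightarrow> 'p mod_ring" where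
  "dotp l v = (\<Sum>i\<in>UNIV. l $ i * v $ i)"

lemma dotp_commute: "dotp l v = dotp v l"
  by (simp add: dotp_def mult.commute)

lemma dotp_add: "dotp l (u + v) = dotp l u + dotp l v"
  by (simp add: dotp_def algebra_simps sum.distrib)

lemma dotp_diff: "dotp l (u - v) = dotp l u - dotp l v"
  by (simp add: dotp_def algebra_simps sum_subtractf)

lemma dotp_zero: "dotp l 0 = 0"
  by (simp add: dotp_def)

lemma dotp_scale: "dotp l (c *s v) = c * dotp l v"
  by (simp add: dotp_def sum_distrib_left mult.left_commute)

lemma surj_dotp:
  assumes "l \<noteq> 0"
  shows "surj (dotp l)"
proof -
  obtain i where i: "l $ i \<noteq> 0" using assms by (auto simp: vec_eq_iff)
  have "dotp l (axis i (t / l $ i)) = t" for t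
    using i by (simp add: dotp_def axis_def if_distrib[of "\<lambda>x. _ * x"] cong: if_cong)
  then show ?thesis by (rule surjI)
qed

text \<open>Double counting: for \<open>u\<close> in \<open>S\<close> and \<open>v\<close> outside,
  parallel hyperplanes through \<open>u\<close> and \<open>v\<close> contain equally many points of
  \<open>S\<close>. Summed over all normals, a point other than the base point counts
  \<open>M\<close> times, but \<open>u\<close> itself counts \<open>card ?V\<close> times.\<close>

lemma equidistributed_all_directions:
  fixes S :: "('p::prime_card mod_ring ^ 'd) set"
  assumes eq: "\<And>l. l \<noteq> 0 \<Longrightarrow> equidistributed (dotp l) S" and "S \<noteq> {}"
  shows "S = UNIV"
proof (rule ccontr)
  assume "S \<noteq> UNIV"
  then obtain u v where u: "u \<in> S" and v: "v \<notin> S" using \<open>S \<noteq> {}\<close> by blast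
  let ?V = "UNIV :: ('p mod_ring ^ 'd) set"
  define M where "M = card ?V div CARD('p)"
  \<comment> \<open>By symmetry of \<open>dotp\<close>, the functionals vanishing at
    \<open>w\<close> form a fibre of the surjection \<open>dotp w\<close>, so their number does not
    depend on \<open>w\<close>.\<close>
  have M: "card {l. dotp l w = 0} = M" "M * CARD('p) = card ?V" if "w \<noteq> 0" for w :: "'p mod_ring ^ 'd"
  proof -
    obtain c where c: "\<And>t. card {l \<in> UNIV. dotp w l = t} = c"
      using equidistributed_UNIV[OF dotp_add surj_dotp[OF \<open>w \<noteq> 0\<close>]] by (auto simp: equidistributed_def)
    then have "card ?V = c * CARD('p)" by (rule equidistributed_card)
    with c[of 0] show "card {l. dotp l w = 0} = M" "M * CARD('p) = card ?V"
      by (simp_all add: M_def dotp_commute[of _ w])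
  qed
  txt \<open>Count the pairs \<open>(l, w)\<close> with \<open>w\<close> on the hyperplane through \<open>z\<close> with normal \<open>l\<close>.\<close>
  define N where "N z = (\<Sum>l\<in>?V. card {w \<in> S. dotp l w = dotp l z})" for z
  have "card {w \<in> S. dotp l w = dotp l u} = card {w \<in> S. dotp l w = dotp l v}" for l
  proof (cases "l = 0")
    case True
    then show ?thesis by (simp add: dotp_def)
  next
    case False
    then show ?thesis using eq[of l] by (auto simp: equidistributed_def)
  qed
  then have "N u = N v" by (simp add: N_def)
  moreover have N: "N z = (\<Sum>w\<in>S. if w = z then card ?V else M)" for z
  proof -
    have "N z = (\<Sum>l\<in>?V. \<Sum>w\<in>S. if dotp l w = dotp l z then 1 else 0)"
      by (simp add: N_def sum.If_cases Int_def)
    also have "\<dots> = (\<Sum>w\<in>S. \<Sum>l\<in>?V. if dotp l w = dotp l z then 1 else 0)"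
      by (rule sum.swap)
    also have "\<dots> = (\<Sum>w\<in>S. card {l. dotp l (w - z) = 0})"
      by (simp add: sum.If_cases dotp_diff)
    also have "\<dots> = (\<Sum>w\<in>S. if w = z then card ?V else M)"
      by (rule sum.cong) (simp_all add: M dotp_zero)
    finally show ?thesis .
  qed
  moreover have "N v = M * card S"
  proof -
    have "N v = (\<Sum>w\<in>S. M)" unfolding N using v by (intro sum.cong) auto
    then show ?thesis by simp
  qed
  moreover have "N u = card ?V + M * (card S - 1)"
  proof -
    have "N u = card ?V + (\<Sum>w\<in>S - {u}. if w = u then card ?V else M)"
      unfolding N using u by (subst sum.remove[of S u]) auto
    also have "(\<Sum>w\<in>S - {u}. if w = u then card ?V else M) = (\<Sum>w\<in>S - {u}. M)"
      by (intro sum.cong) auto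
    finally show ?thesis using u by (simp add: card_Diff_singleton)
  qed
  moreover have "M * card S = M + M * (card S - 1)"
    using u by (cases "card S") auto
  \<comment> \<open>Comparing the two counts leaves \<open>card ?V = M\<close>, while
    \<open>M\<close> is only the \<open>p\<close>-th part of \<open>card ?V\<close>.\<close>
  ultimately have "card ?V = M" by simp
  moreover have "M * CARD('p) = card ?V"
    using M(2)[of "u - v"] u v by auto
  moreover have "CARD('p) \<noteq> 1" using prime_card[where 'a = 'p] by auto
  ultimately show False by simp
qed

section \<open>Adapted bases and the decomposition into graphs\<close>

lemma exists_dual_basis:
  fixes l :: "'p::prime_card mod_ring ^ 2"
  assumes "l \<noteq> 0"
  obtains e\<^sub>1 e\<^sub>2 where "is_basis2 e\<^sub>1 e\<^sub>2" "dotp l e\<^sub>1 = 1" "dotp l e\<^sub>2 = 0"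
proof -
  obtain e\<^sub>1 where e1: "dotp l e\<^sub>1 = 1" using surj_dotp[OF assms] by (metis surjD)
  \<comment> \<open>This is \<open>l\<close> turned by a right angle; it spans the kernel of
    \<open>dotp l\<close>.\<close>
  define e\<^sub>2 :: "'p mod_ring ^ 2" where "e\<^sub>2 = (\<chi> i. if i = 1 then - l $ 2 else l $ 1)"
  have e2: "dotp l e\<^sub>2 = 0" by (simp add: dotp_def e\<^sub>2_def sum_2)
  have "e\<^sub>2 \<noteq> 0" using assms by (auto simp: e\<^sub>2_def vec_eq_iff forall_2)
  have det: "e\<^sub>1 $ 1 * l $ 1 + e\<^sub>1 $ 2 * l $ 2 = 1"
    using e1 by (simp add: dotp_def sum_2 mult.commute)
  \<comment> \<open>Cramer's rule: \<open>det\<close> says that the determinant of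
    \<open>e\<^sub>1\<close> and \<open>e\<^sub>2\<close> is 1, and the coefficient of
    \<open>e\<^sub>2\<close> is the determinant of \<open>e\<^sub>1\<close> and
    \<open>v\<close>.\<close>
  have decomp: "v = dotp l v *s e\<^sub>1 + (e\<^sub>1 $ 1 * v $ 2 - e\<^sub>1 $ 2 * v $ 1) *s e\<^sub>2" for v
  proof -
    have "v $ 1 = v $ 1 * (e\<^sub>1 $ 1 * l $ 1 + e\<^sub>1 $ 2 * l $ 2)"
      "v $ 2 = v $ 2 * (e\<^sub>1 $ 1 * l $ 1 + e\<^sub>1 $ 2 * l $ 2)"
      by (simp_all add: det)
    then show ?thesis
      by (simp add: vec_eq_iff forall_2 e\<^sub>2_def dotp_def sum_2 algebra_simps)
  qed
  have "e\<^sub>1 \<noteq> e\<^sub>2" using e1 e2 by auto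
  moreover have "e\<^sub>1 \<notin> vec.span {e\<^sub>2}"
    using e1 e2 by (auto simp: vec.span_singleton dotp_scale)
  then have "vec.independent {e\<^sub>1, e\<^sub>2}"
    using \<open>e\<^sub>2 \<noteq> 0\<close> by (simp add: vec.independent_insert)
  moreover have "v \<in> vec.span {e\<^sub>1, e\<^sub>2}" for v
    by (subst decomp) (intro vec.span_add vec.span_scale vec.span_base; simp)
  ultimately have "is_basis2 e\<^sub>1 e\<^sub>2" by (auto simp: is_basis2_def)
  with e1 e2 that show ?thesis by blast
qed

text \<open>The first coordinate in this basis is \<open>dotp l\<close>, so each line parallel to
  \<open>e\<^sub>2\<close> carries \<open>s\<close> points of \<open>E\<close>. Numbering them from
  1 to \<open>s\<close> on every line separately, the points with number \<open>i\<close> form the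
  graph of \<open>f i\<close>.\<close>

lemma equidistributed_union_graphs:
  fixes E :: "('p::prime_card mod_ring ^ 2) set"
  assumes basis: "is_basis2 e\<^sub>1 e\<^sub>2" and l: "dotp l e\<^sub>1 = 1" "dotp l e\<^sub>2 = 0"
    and card: "\<And>t. card {v \<in> E. dotp l v = t} = s"
  obtains f :: "nat \<Rightarrow> 'p mod_ring \<Rightarrow> 'p mod_ring" where
    "disjoint_family_on (\<lambda>i. graph_in e\<^sub>1 e\<^sub>2 (f i)) {1..s}"
    "E = (\<Union>i\<in>{1..s}. graph_in e\<^sub>1 e\<^sub>2 (f i))"
proof -
  define Y where "Y x = {y. x *s e\<^sub>1 + y *s e\<^sub>2 \<in> E}" for x
  have dotp: "dotp l (x *s e\<^sub>1 + y *s e\<^sub>2) = x" for x y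
    by (simp add: dotp_add dotp_scale l)
  have "e\<^sub>2 \<noteq> 0"
    using basis vec.dependent_zero[of "{e\<^sub>1, e\<^sub>2}"] by (auto simp: is_basis2_def)
  then have inj: "y = y'" if "x *s e\<^sub>1 + y *s e\<^sub>2 = x *s e\<^sub>1 + y' *s e\<^sub>2" for x y y'
    using that by (simp add: vec.scale_right_imp_eq)
  have decomp: "\<exists>y. v = dotp l v *s e\<^sub>1 + y *s e\<^sub>2" for v
  proof -
    have "v \<in> vec.span {e\<^sub>1, e\<^sub>2}" using basis by (simp add: is_basis2_def)
    then obtain x y where v: "v = x *s e\<^sub>1 + y *s e\<^sub>2"
      by (auto simp: vec.span_insert vec.span_singleton algebra_simps)
    then show ?thesis using dotp by metis
  qed
  have "card (Y x) = s" for x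
  proof -
    have "bij_betw (\<lambda>y. x *s e\<^sub>1 + y *s e\<^sub>2) (Y x) {v \<in> E. dotp l v = x}"
      unfolding bij_betw_def
    proof
      show "inj_on (\<lambda>y. x *s e\<^sub>1 + y *s e\<^sub>2) (Y x)" using inj by (auto intro!: inj_onI)
      show "(\<lambda>y. x *s e\<^sub>1 + y *s e\<^sub>2) ` Y x = {v \<in> E. dotp l v = x}"
      proof (intro equalityI subsetI)
        fix v assume v: "v \<in> {v \<in> E. dotp l v = x}"
        then obtain y where "v = x *s e\<^sub>1 + y *s e\<^sub>2" using decomp[of v] by auto
        with v show "v \<in> (\<lambda>y. x *s e\<^sub>1 + y *s e\<^sub>2) ` Y x" by (auto simp: Y_def)
      qed (auto simp: Y_def dotp)
    qed
    from bij_betw_same_card[OF this] show ?thesis by (simp only: card)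
  qed
  then have "\<exists>h. bij_betw h {1..s} (Y x)" for x
    using ex_bij_betw_nat_finite_1[of "Y x"] by auto
  then obtain h where h: "\<And>x. bij_betw (h x) {1..s} (Y x)" by metis
  show ?thesis
  proof (rule that[of "\<lambda>i x. h x i"])
    show "disjoint_family_on (\<lambda>i. graph_in e\<^sub>1 e\<^sub>2 (\<lambda>x. h x i)) {1..s}"
      unfolding disjoint_family_on_def
    proof (intro ballI impI)
      fix i j assume ij: "i \<in> {1..s}" "j \<in> {1..s}" "i \<noteq> j"
      have "x *s e\<^sub>1 + h x i *s e\<^sub>2 \<noteq> x' *s e\<^sub>1 + h x' j *s e\<^sub>2" for x x'
      proof
        assume eq: "x *s e\<^sub>1 + h x i *s e\<^sub>2 = x' *s e\<^sub>1 + h x' j *s e\<^sub>2"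
        then have x: "x = x'" by (metis dotp)
        then have "h x i = h x j" using eq inj by blast
        then show False using ij inj_onD[OF bij_betw_imp_inj_on[OF h[of x]]] by blast
      qed
      then show "graph_in e\<^sub>1 e\<^sub>2 (\<lambda>x. h x i) \<inter> graph_in e\<^sub>1 e\<^sub>2 (\<lambda>x. h x j) = {}"
        by (auto simp: graph_in_def)
    qed
    show "E = (\<Union>i\<in>{1..s}. graph_in e\<^sub>1 e\<^sub>2 (\<lambda>x. h x i))"
    proof (intro equalityI subsetI)
      fix v assume "v \<in> E"
      obtain y where y: "v = dotp l v *s e\<^sub>1 + y *s e\<^sub>2" using decomp[of v] ..
      then have "y \<in> Y (dotp l v)" using \<open>v \<in> E\<close> by (simp add: Y_def)
      then obtain i where "i \<in> {1..s}" "y = h (dotp l v) i"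
        using bij_betw_imp_surj_on[OF h[of "dotp l v"]] by blast
      then show "v \<in> (\<Union>i\<in>{1..s}. graph_in e\<^sub>1 e\<^sub>2 (\<lambda>x. h x i))"
        using y by (auto simp: graph_in_def)
    next
      fix v assume "v \<in> (\<Union>i\<in>{1..s}. graph_in e\<^sub>1 e\<^sub>2 (\<lambda>x. h x i))"
      then obtain i x where ix: "i \<in> {1..s}" "v = x *s e\<^sub>1 + h x i *s e\<^sub>2"
        by (auto simp: graph_in_def)
      then have "h x i \<in> Y x" using bij_betwE[OF h[of x]] by blast
      then show "v \<in> E" using ix by (simp add: Y_def)
    qed
  qed
qed

theorem mainTheorem3:
  fixes E A :: "('p::prime_card mod_ring ^ 2) set" and k :: nat
  assumes "k_tiles k E A"
  shows "(card E = k \<and> A = UNIV)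
       \<or> (E = UNIV \<and> card A = k)
       \<or> (\<exists>s::nat. 1 \<le> s \<and> s \<le> CARD('p) - 1 \<and> card E = s * CARD('p) \<and> s dvd k \<and>
            (\<exists>e\<^sub>1 e\<^sub>2. is_basis2 e\<^sub>1 e\<^sub>2 \<and>
              (\<exists>f :: nat \<Rightarrow> 'p mod_ring \<Rightarrow> 'p mod_ring.
                 disjoint_family_on (\<lambda>i. graph_in e\<^sub>1 e\<^sub>2 (f i)) {1..s} \<and>
                 E = (\<Union>i\<in>{1..s}. graph_in e\<^sub>1 e\<^sub>2 (f i)))))"
proof -
  let ?p = "CARD('p)"
  have k: "k \<ge> 1" and tiling: "\<And>x. (\<Sum>a\<in>A. indicator E (x - a)) = k"
    using assms by (auto simp: k_tiles_def)
  have V: "CARD('p mod_ring ^ 2) = ?p * ?p"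
    by (simp add: power2_eq_square)
  have p0: "?p > 0" by simp
  have "int (card A * card E) = int (k * (?p * ?p))"
    using sum_tiling[OF tiling, of "\<lambda>_. 1::int"] by (simp add: power2_eq_square)
  then have cards: "card A * card E = k * (?p * ?p)" by (simp only: of_nat_eq_iff)
  then have "card A * card E > 0" using k p0 by simp
  then have ne: "E \<noteq> {}" "A \<noteq> {}" by auto
  have dich: "equidistributed (dotp l) E \<or> equidistributed (dotp l) A" if "l \<noteq> 0" for l
    by (rule tiling_equidistributed[OF tiling dotp_add surj_dotp[OF that]])
  show ?thesis
  proof (cases "A = UNIV \<or> E = UNIV")
    case True
    then show ?thesis using cards V p0 by auto
  next
    case False
    \<comment> \<open>The roles cross: as \<open>A\<close> is not the whole plane, it fails to be
      equidistributed in some direction \<open>l\<close>, and there \<open>E\<close> must be;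
      likewise \<open>m\<close> comes from \<open>E\<close>.\<close>
    then obtain l m where l: "l \<noteq> 0" "equidistributed (dotp l) E"
      and m: "m \<noteq> 0" "equidistributed (dotp m) A"
      using dich ne equidistributed_all_directions[of E] equidistributed_all_directions[of A] by metis
    obtain s where s: "\<And>t. card {v \<in> E. dotp l v = t} = s"
      using l by (auto simp: equidistributed_def)
    obtain r where r: "\<And>t. card {v \<in> A. dotp m v = t} = r"
      using m by (auto simp: equidistributed_def)
    have cE: "card E = s * ?p" and cA: "card A = r * ?p"
      using equidistributed_card s r by blast+
    have "r * s = k" using cards p0 by (simp add: cE cA)
    then have "s dvd k" by auto
    \<comment> \<open>The bound \<open>s \<le> p - 1\<close> comes from \<open>E\<close> being a
      proper subset of the plane.\<close>
    have "card E < ?p * ?p"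
      using False psubset_card_mono[of UNIV E] V by auto
    then have "s < ?p" by (simp add: cE)
    moreover have "s \<noteq> 0" using \<open>r * s = k\<close> k by auto
    moreover obtain e\<^sub>1 e\<^sub>2 where e: "is_basis2 e\<^sub>1 e\<^sub>2" "dotp l e\<^sub>1 = 1" "dotp l e\<^sub>2 = 0"
      using exists_dual_basis[OF l(1)] by blast
    moreover obtain f where "disjoint_family_on (\<lambda>i. graph_in e\<^sub>1 e\<^sub>2 (f i)) {1..s}"
      "E = (\<Union>i\<in>{1..s}. graph_in e\<^sub>1 e\<^sub>2 (f i))"
      using equidistributed_union_graphs[OF e s] by blast
    ultimately show ?thesis
      using cE \<open>s dvd k\<close> by (intro disjI2 exI[of _ s]) auto
  qed
qed

end
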